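(* Let $G$ be a graph and let $m\in\mathbb N$ with $\operatorname{Z}(G)\le m\le |V(G)|$. Then $$\operatorname{pt}_+(G,m)\le\left\lceil\frac{\operatorname{pt}(G,m)}{2}\right\rceil.$$
   Context: All graphs are finite, simple and undirected. Each vertex is blue or white; blue vertices stay blue. Standard rule: a blue vertex $u$ with exactly one white neighbor $v$ can force $v$ to become blue. PSD rule: if $B$ is the current set of blue vertices, $C$ is a connected component of $G-B$, and $u\in B$ satisfies $N_G(u)\cap V(C)=\{v\}$, then $u$ can force $v$ to become blue. For either rule and initial blue set $B$, put $B^{[0]}=B$, and let $B^{[k]}$ be the union of $B^{[k-1]}$ and the set of all vertices that can be forced by some vertex when exactly $B^{[k-1]}$ is blue. $B$ is a standard zero forcing set (resp. PSD forcing set) if $B^{[k]}=V(G)$ for some $k$ under the standard (resp. PSD) rule; the least such $k$ is $\operatorname{pt}(G,B)$ (resp. $\operatorname{pt}_+(G,B)$). $\operatorname{Z}(G)$ is the minimum size of a standard zero forcing set. $\operatorname{pt}(G,m)$ is the minimum of $\operatorname{pt}(G,B)$ over standard zero forcing sets $B$ with $|B|=m$, and $\operatorname{pt}_+(G,m)$ is the minimum of $\operatorname{pt}_+(G,B)$ over PSD forcing sets $B$ with $|B|=m$. *)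

theory Defs
  imports Complex_Main "Graph_Theory.Graph_Theory"
begin

text \<open>
  Finite simple undirected graphs are the graphs satisfying \<^locale>\<open>pair_graph\<close>: finitely many
  vertices, and each edge represented by its two arcs, with no loops. The empty graph is allowed.
\<close>

definition nbhd :: "'a pair_pre_digraph \<Rightarrow> 'a \<Rightarrow> 'a set" where
  "nbhd G u = {w. (u, w) \<in> parcs G}"

text \<open>Since arcs are symmetric, the strong components of \<open>G - B\<close> are its connected components.\<close>

definition components_minus :: "'a pair_pre_digraph \<Rightarrow> 'a set \<Rightarrow> ('a, 'a \<times> 'a) pre_digraph set" where
  "components_minus G B = pre_digraph.sccs (with_proj G \<restriction> (pverts G - B))"

definition std_force :: "'a pair_pre_digraph \<Rightarrow> 'a set \<Rightarrow> 'a \<Rightarrow> 'a \<Rightarrow> bool" where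
  "std_force G B u v \<longleftrightarrow> u \<in> B \<and> nbhd G u - B = {v}"

definition psd_force :: "'a pair_pre_digraph \<Rightarrow> 'a set \<Rightarrow> 'a \<Rightarrow> 'a \<Rightarrow> bool" where
  "psd_force G B u v \<longleftrightarrow> u \<in> B \<and> (\<exists>C \<in> components_minus G B. nbhd G u \<inter> verts C = {v})"

text \<open>
  In the following generic notions, \<open>F\<close> is a colour change rule:
  \<open>F B u v\<close> says that \<open>u\<close> can force \<open>v\<close> when exactly \<open>B\<close> is blue.
\<close>

primrec blue_after :: "('a set \<Rightarrow> 'a \<Rightarrow> 'a \<Rightarrow> bool) \<Rightarrow> 'a set \<Rightarrow> nat \<Rightarrow> 'a set" where
  "blue_after F B 0 = B"
| "blue_after F B (Suc k) = blue_after F B k \<union> {v. \<exists>u. F (blue_after F B k) u v}"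

definition forcing_set ::
    "('a set \<Rightarrow> 'a \<Rightarrow> 'a \<Rightarrow> bool) \<Rightarrow> 'a pair_pre_digraph \<Rightarrow> 'a set \<Rightarrow> bool" where
  "forcing_set F G B \<longleftrightarrow> B \<subseteq> pverts G \<and> (\<exists>k. blue_after F B k = pverts G)"

definition prop_time_set ::
    "('a set \<Rightarrow> 'a \<Rightarrow> 'a \<Rightarrow> bool) \<Rightarrow> 'a pair_pre_digraph \<Rightarrow> 'a set \<Rightarrow> nat" where
  "prop_time_set F G B = (LEAST k. blue_after F B k = pverts G)"

text \<open>Only meaningful if \<open>G\<close> has a forcing set of size \<open>m\<close>; otherwise this is the minimum of the empty set.\<close>

definition prop_time ::
    "('a set \<Rightarrow> 'a \<Rightarrow> 'a \<Rightarrow> bool) \<Rightarrow> 'a pair_pre_digraph \<Rightarrow> nat \<Rightarrow> nat" where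
  "prop_time F G m = Min (prop_time_set F G ` {B. forcing_set F G B \<and> card B = m})"

definition zero_forcing_number :: "'a pair_pre_digraph \<Rightarrow> nat" where
  "zero_forcing_number G = Min (card ` {B. forcing_set (std_force G) G B})"

definition pt :: "'a pair_pre_digraph \<Rightarrow> nat \<Rightarrow> nat" where
  "pt G m = prop_time (std_force G) G m"

definition pt_plus :: "'a pair_pre_digraph \<Rightarrow> nat \<Rightarrow> nat" where
  "pt_plus G m = prop_time (psd_force G) G m"

end

theory Submission
  imports Defs
begin

text \<open>
  Fix a standard forcing process of duration \<open>t\<close> with one forcer chosen for every forced vertex,
  let \<open>s = \<lfloor>t/2\<rfloor>\<close>, and let \<open>B'\<close> consist of the vertices that are blue at time \<open>s\<close> and have not yet
  performed a force. Forcing being injective, \<open>B'\<close> is as large as the initial set. A vertex that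
  has already forced has only blue neighbours, so \<open>B'\<close> separates the vertices that have
  forced by time \<open>s\<close> (the past) from those that are still white (the future). Under the PSD rule
  the two sides therefore evolve independently: the future by the original forces, in
  \<open>t - s\<close> steps, and the past by the reversed forces, in \<open>s\<close> steps.
\<close>

section \<open>Single forces\<close>

text \<open>The white part of \<open>P\<close> is closed under adjacency among white vertices, so
  the component of \<open>v\<close> lies inside \<open>P\<close> and \<open>v\<close> is the only
  neighbour of \<open>u\<close> in it. Forces can thus be checked without computing
  components.\<close>

lemma psd_forceI:
  assumes "pair_graph G" "u \<in> S" "v \<in> pverts G" "v \<notin> S" "v \<in> P"
    and nb: "nbhd G u \<inter> P - S = {v}"
    and closed: "\<And>x y. x \<in> P \<Longrightarrow> x \<notin> S \<Longrightarrow> (x, y) \<in> parcs G \<Longrightarrow> y \<notin> S \<Longrightarrow> y \<in> P"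
  shows "psd_force G S u v"
proof -
  interpret pair_graph G by fact
  let ?H = "with_proj G \<restriction> (pverts G - S)"
  interpret H: wf_digraph ?H
    by (rule wellformed_induce_subgraph)
  have v: "v \<in> verts ?H"
    using assms by simp
  define C where "C = pre_digraph.scc_of ?H v"
  have "C \<in> H.sccs_verts"
    unfolding C_def using v by (rule H.scc_of_in_sccs_verts)
  then obtain D where D: "D \<in> H.sccs" "verts D = C"
    by (auto simp: H.sccs_verts_conv)
  have "v \<in> C"
    unfolding C_def using v by (rule H.in_scc_of_self)
  have "C \<subseteq> verts ?H"
    unfolding C_def using v by (intro H.sccs_verts_subsets H.scc_of_in_sccs_verts)
  moreover have "y \<in> P - S" if "v \<rightarrow>\<^sup>*\<^bsub>?H\<^esub> y" for y
    using that
  proof (induction rule: H.reachable_induct)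
    case base
    then show ?case using assms by simp
  next
    case (step x y)
    then have "y \<in> verts ?H" "(x, y) \<in> parcs G"
      by (auto simp: arcs_ends_conv)
    then show ?case using step closed[of x y] by simp
  qed
  then have "C \<subseteq> P"
    by (auto simp: C_def H.scc_of_def)
  ultimately have "nbhd G u \<inter> verts D = {v}"
    using nb \<open>v \<in> C\<close> D by auto
  then show ?thesis
    using D assms by (auto simp: psd_force_def components_minus_def)
qed

lemma psd_force_in_verts:
  assumes "pair_graph G" "psd_force G S u v"
  shows "v \<in> pverts G"
proof -
  interpret pair_graph G by fact
  show ?thesis
    using assms(2) by (auto simp: psd_force_def nbhd_def dest: in_arcsD2)
qed

lemma std_force_in_verts:
  assumes "pair_graph G" "std_force G S u v"
  shows "v \<in> pverts G"
proof -
  interpret pair_graph G by fact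
  show ?thesis
    using assms(2) by (auto simp: std_force_def nbhd_def dest: in_arcsD2)
qed

section \<open>Growth of blue sets and existence of forcing sets\<close>

lemma blue_after_subset:
  assumes "\<And>S u v. F S u v \<Longrightarrow> v \<in> V" "B \<subseteq> V"
  shows "blue_after F B k \<subseteq> V"
  using assms by (induction k) auto

lemma blue_after_mono_time: "j \<le> k \<Longrightarrow> blue_after F B j \<subseteq> blue_after F B k"
  by (rule lift_Suc_mono_le[of "blue_after F B"]) auto

text \<open>Enlarging the blue set can only shrink the white neighbourhood of a forcer: the vertex
  it forces is still its only white neighbour or is already blue.\<close>

lemma blue_after_std_mono:
  assumes "B \<subseteq> B'"
  shows "blue_after (std_force G) B k \<subseteq> blue_after (std_force G) B' k"
proof (induction k)
  case (Suc k)
  show ?case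
  proof
    fix v assume "v \<in> blue_after (std_force G) B (Suc k)"
    then consider "v \<in> blue_after (std_force G) B k"
      | u where "std_force G (blue_after (std_force G) B k) u v"
      by auto
    then show "v \<in> blue_after (std_force G) B' (Suc k)"
    proof cases
      case (2 u)
      then have "v \<in> blue_after (std_force G) B' k \<or>
          std_force G (blue_after (std_force G) B' k) u v"
        using Suc unfolding std_force_def by blast
      then show ?thesis by auto
    qed (use Suc in auto)
  qed
qed (use assms in simp)

lemma forcing_set_std_superset:
  assumes "pair_graph G" "forcing_set (std_force G) G B" "B \<subseteq> B'" "B' \<subseteq> pverts G"
  shows "forcing_set (std_force G) G B'"
proof -
  obtain k where "blue_after (std_force G) B k = pverts G"
    using assms by (auto simp: forcing_set_def)
  then have "blue_after (std_force G) B' k = pverts G"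
    using blue_after_std_mono[OF assms(3), of G k]
      blue_after_subset[of "std_force G" "pverts G" B' k] std_force_in_verts[OF assms(1)] assms(4)
    by blast
  then show ?thesis
    using assms by (auto simp: forcing_set_def)
qed

text \<open>Pad a minimum forcing set to size \<open>m\<close>. This makes the minimum in
  \<open>pt G m\<close> range over a nonempty set.\<close>

lemma forcing_set_std_card_exists:
  assumes "pair_graph G" "zero_forcing_number G \<le> m" "m \<le> card (pverts G)"
  shows "\<exists>B. forcing_set (std_force G) G B \<and> card B = m"
proof -
  interpret pair_graph G by fact
  let ?A = "{B. forcing_set (std_force G) G B}"
  have "?A \<subseteq> Pow (pverts G)"
    by (auto simp: forcing_set_def)
  then have fin: "finite ?A"
    using pair_finite_verts finite_subset by blast
  have "pverts G \<in> ?A"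
    by (auto simp: forcing_set_def intro: exI[of _ 0])
  then have "zero_forcing_number G \<in> card ` ?A"
    unfolding zero_forcing_number_def using fin by (intro Min_in) auto
  then obtain B where B: "forcing_set (std_force G) G B" "card B \<le> m"
    using assms by auto
  then have "B \<subseteq> pverts G"
    by (simp add: forcing_set_def)
  with B assms obtain B' where "B \<subseteq> B'" "B' \<subseteq> pverts G" "card B' = m"
    using exists_subset_between[of B m "pverts G"] pair_finite_verts by blast
  then show ?thesis
    using forcing_set_std_superset assms B by blast
qed

section \<open>Running a standard process outwards from time \<open>s\<close>\<close>

lemma psd_forcing_from_std_midpoint:
  assumes "pair_graph G" "B \<subseteq> pverts G"
    and t: "blue_after (std_force G) B t = pverts G" and "s \<le> t"
  shows "\<exists>B'\<subseteq>pverts G. card B' = card B \<and>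
    blue_after (psd_force G) B' (max s (t - s)) = pverts G"
proof -
  interpret pair_graph G by fact
  define X where "X k = blue_after (std_force G) B k" for k
  define V where "V = pverts G"
  define \<tau> where "\<tau> v = (LEAST k. v \<in> X k)" for v
  define W where "W = V - B"
  have XV: "X k \<subseteq> V" for k
    unfolding X_def V_def using std_force_in_verts[OF assms(1)] assms(2)
    by (rule blue_after_subset)
  have X_iff: "v \<in> X k \<longleftrightarrow> \<tau> v \<le> k" if "v \<in> V" for v k
  proof
    show "\<tau> v \<le> k" if "v \<in> X k"
      unfolding \<tau>_def using that by (rule Least_le)
    have "v \<in> X (\<tau> v)"
      unfolding \<tau>_def by (rule LeastI[of _ t]) (use that t in \<open>simp add: X_def V_def\<close>)
    then show "v \<in> X k" if "\<tau> v \<le> k"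
      using blue_after_mono_time[OF that, of "std_force G" B] by (auto simp: X_def)
  qed
  have \<tau>_0: "\<tau> v = 0 \<longleftrightarrow> v \<in> B" if "v \<in> V" for v
    using X_iff[OF that, of 0] by (simp add: X_def)
  have \<tau>_t: "\<tau> v \<le> t" if "v \<in> V" for v
    using X_iff[OF that, of t] that t by (simp add: X_def V_def)
  have "\<exists>u. std_force G (X (\<tau> v - 1)) u v" if "v \<in> W" for v
  proof -
    have "v \<in> V" "\<tau> v \<noteq> 0"
      using that \<tau>_0 by (auto simp: W_def)
    then obtain k where k: "\<tau> v = Suc k"
      using not0_implies_Suc by blast
    then have "v \<in> X (Suc k)" "v \<notin> X k"
      using X_iff \<open>v \<in> V\<close> by auto
    then show ?thesis
      using k by (auto simp: X_def)
  qed
  then obtain f where f: "\<And>v. v \<in> W \<Longrightarrow> std_force G (X (\<tau> v - 1)) (f v) v"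
    by metis
  have WV: "v \<in> V" and W_pos: "\<tau> v > 0" if "v \<in> W" for v
    using that \<tau>_0 by (auto simp: W_def)
  have f_V: "f v \<in> V" and f_less: "\<tau> (f v) < \<tau> v" and f_nb: "(f v, v) \<in> parcs G"
    if "v \<in> W" for v
  proof -
    have *: "f v \<in> X (\<tau> v - 1)" "nbhd G (f v) - X (\<tau> v - 1) = {v}"
      using f[OF that] by (auto simp: std_force_def)
    then show "f v \<in> V" using XV by blast
    then show "\<tau> (f v) < \<tau> v" using * X_iff[of "f v" "\<tau> v - 1"] W_pos[OF that] by simp
    show "(f v, v) \<in> parcs G" using *(2) by (auto simp: nbhd_def)
  qed
  \<comment> \<open>The form in which the standard rule is used below: when \<open>f v\<close>
    forces \<open>v\<close>, all its other neighbours are blue already.\<close>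
  have f_nbs: "y = v \<or> \<tau> y < \<tau> v" if "v \<in> W" "(f v, y) \<in> parcs G" for v y
  proof -
    have "nbhd G (f v) - X (\<tau> v - 1) = {v}"
      using f[OF that(1)] by (simp add: std_force_def)
    moreover have "y \<in> V"
      using that(2) in_arcsD2 by (auto simp: V_def)
    moreover have "y \<in> nbhd G (f v)"
      using that(2) by (simp add: nbhd_def)
    ultimately show ?thesis
      using X_iff[of y "\<tau> v - 1"] W_pos[OF that(1)] by fastforce
  qed
  \<comment> \<open>Two distinct vertices with a common forcer would each have to turn blue strictly
    before the other.\<close>
  have f_inj: "v = w" if "v \<in> W" "w \<in> W" "f v = f w" for v w
    using f_nbs[OF that(1), of w] f_nbs[OF that(2), of v] f_nb[OF that(1)] f_nb[OF that(2)] that(3)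
    by auto

  text \<open>
    The vertices guaranteed to be blue after \<open>k\<close> PSD steps: those the standard process colours by time \<open>s + k\<close>
    that have not performed their own force by time \<open>s - k\<close>, stated without subtraction.
  \<close>
  define T where "T k = {v \<in> V. \<tau> v \<le> s + k \<and> (\<forall>w\<in>W. f w = v \<longrightarrow> s < \<tau> w + k)}" for k
  define Y where "Y k = blue_after (psd_force G) (T 0) k" for k
  have T_mono: "T j \<subseteq> T k" if "j \<le> k" for j k
    using that by (fastforce simp: T_def)
  have YV: "Y k \<subseteq> V" for k
    unfolding Y_def V_def using psd_force_in_verts[OF assms(1)]
    by (rule blue_after_subset) (auto simp: T_def V_def)
  have past: "\<exists>w\<in>W. f w = v \<and> \<tau> w \<le> s" if "v \<in> V" "\<tau> v \<le> s" "v \<notin> T 0" for v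
    using that by (auto simp: T_def)

  have TY: "T k \<subseteq> Y k" for k
  proof (induction k)
    case 0
    then show ?case by (simp add: Y_def)
  next
    case (Suc k)
    have T0: "T 0 \<subseteq> Y k"
      using T_mono[of 0 k] Suc by auto
    show ?case
    proof
      fix x assume x: "x \<in> T (Suc k)"
      then have xV: "x \<in> V" by (simp add: T_def)
      have "\<exists>u. psd_force G (Y k) u x" if xY: "x \<notin> Y k"
      proof -
        have "x \<notin> T k" using xY Suc by auto
        \<comment> \<open>One of the two conditions defining \<open>T\<close> first becomes true at
          \<open>Suc k\<close>, which turns its inequality into an equation: \<open>x\<close> is
          forced at time \<open>s + k + 1\<close>, or its own force took place at time
          \<open>s - k\<close> and is now reversed.\<close>
        then consider (forward) "\<tau> x = s + k + 1" | (backward) w where "w \<in> W" "f w = x" "\<tau> w + k = s"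
          using x by (fastforce simp: T_def)
        then show ?thesis
        proof cases
          case future: forward
          then have xW: "x \<in> W"
            using xV \<tau>_0[of x] by (auto simp: W_def)
          \<comment> \<open>By injectivity the only force of \<open>f x\<close> is the one on
            \<open>x\<close>, which is late enough.\<close>
          have "s < \<tau> w + k" if "w \<in> W" "f w = f x" for w
            using f_inj[OF that(1) xW that(2)] future by simp
          then have uT: "f x \<in> T k"
            using f_V[OF xW] f_less[OF xW] future by (auto simp: T_def)
          have nb: "nbhd G (f x) \<inter> {v \<in> V. s < \<tau> v} - Y k = {x}"
          proof -
            have "y = x" if y: "(f x, y) \<in> parcs G" "s < \<tau> y" "y \<notin> Y k" "y \<in> V" for y
            proof (rule ccontr)
              assume "y \<noteq> x"
              \<comment> \<open>Moreover \<open>y\<close> is itself blue only after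
                \<open>s\<close>, so any force by \<open>y\<close> is later still and
                \<open>y\<close> meets both conditions of \<open>T k\<close>.\<close>
              then have "\<tau> y \<le> s + k"
                using f_nbs[OF xW y(1)] future by simp
              then have "y \<in> T k"
                using y f_less by (fastforce simp: T_def)
              then show False using y Suc by auto
            qed
            then show ?thesis
              using f_nb[OF xW] xV future xY by (auto simp: nbhd_def)
          qed
          have closed: "y \<in> {v \<in> V. s < \<tau> v}"
            if a: "z \<in> {v \<in> V. s < \<tau> v}" "(z, y) \<in> parcs G" "y \<notin> Y k" for z y
          proof -
            have yV: "y \<in> V"
              using a in_arcsD2 by (auto simp: V_def)
            \<comment> \<open>A white vertex of the past has forced by time \<open>s\<close>, so all
              its neighbours are blue by then; \<open>z\<close> is not.\<close>
            have False if le: "\<tau> y \<le> s"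
            proof -
              obtain w where w: "w \<in> W" "f w = y" "\<tau> w \<le> s"
                using past[OF yV le] a T0 by blast
              then show False
                using f_nbs[OF w(1), of z] arcs_symmetric[OF a(2)] a(1) by auto
            qed
            then show ?thesis using yV by force
          qed
          show ?thesis
          proof (rule exI, rule psd_forceI[OF assms(1) _ _ xY _ nb])
            show "f x \<in> Y k" using uT Suc by blast
            show "x \<in> pverts G" using xV by (simp add: V_def)
            show "x \<in> {v \<in> V. s < \<tau> v}" using xV future by simp
            show "y \<in> {v \<in> V. s < \<tau> v}"
              if "z \<in> {v \<in> V. s < \<tau> v}" "(z, y) \<in> parcs G" "y \<notin> Y k" for z y
              using that by (rule closed)
          qed
        next
          case w: backward
          let ?P = "f ` {w \<in> W. \<tau> w \<le> s}"
          \<comment> \<open>Since \<open>w\<close> turned blue at time \<open>s - k\<close>, its own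
            force, if any, came later.\<close>
          have uT: "w \<in> T k"
            using w WV f_less by (fastforce simp: T_def)
          have nb: "nbhd G w \<inter> ?P - Y k = {x}"
          proof -
            have "y = x" if y: "(w, y) \<in> parcs G" "y \<in> ?P" "y \<notin> Y k" for y
            proof -
              obtain z where z: "z \<in> W" "f z = y" "\<tau> z \<le> s"
                using y by auto
              have "y \<notin> T k" using y Suc by auto
              then obtain z' where z': "z' \<in> W" "f z' = y" "\<tau> z' + k \<le> s"
                using z f_V f_less by (fastforce simp: T_def)
              \<comment> \<open>As a neighbour of \<open>y\<close>, the vertex \<open>w\<close> is
                blue before \<open>z'\<close> unless they coincide; this inequality leaves only
                \<open>w = z'\<close>, so \<open>y\<close> is the forcer of
                \<open>w\<close>.\<close>
              then have "\<tau> z' \<le> \<tau> w" using w by simp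
              then have "w = z'"
                using f_nbs[OF z'(1), of w] arcs_symmetric[OF y(1)] z' by auto
              then show ?thesis using w z' by simp
            qed
            then show ?thesis
              using f_nb[OF w(1)] arcs_symmetric w xY by (auto simp: nbhd_def)
          qed
          have closed: "y \<in> ?P"
            if a: "z \<in> ?P" "(z, y) \<in> parcs G" "y \<notin> Y k" for z y
          proof -
            have yV: "y \<in> V"
              using a in_arcsD2 by (auto simp: V_def)
            obtain z' where z': "z' \<in> W" "f z' = z" "\<tau> z' \<le> s"
              using a by auto
            \<comment> \<open>Having forced by time \<open>s\<close>, \<open>z\<close> has no
              neighbour in the future; a white neighbour lies outside \<open>T 0\<close>, so it has
              forced too.\<close>
            then have "\<tau> y \<le> s"
              using f_nbs[OF z'(1), of y] a by auto
            then show ?thesis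
              using past[OF yV] a T0 by blast
          qed
          show ?thesis
          proof (rule exI, rule psd_forceI[OF assms(1) _ _ xY _ nb])
            show "w \<in> Y k" using uT Suc by blast
            show "x \<in> pverts G" using xV by (simp add: V_def)
            show "x \<in> ?P" using w by auto
            show "y \<in> ?P"
              if "z \<in> ?P" "(z, y) \<in> parcs G" "y \<notin> Y k" for z y
              using that by (rule closed)
          qed
        qed
      qed
      then show "x \<in> Y (Suc k)"
        by (auto simp: Y_def)
    qed
  qed

  have "T (max s (t - s)) = V"
  proof -
    \<comment> \<open>No force happens at time 0, so \<open>s\<close> reversed steps already satisfy
      the strict inequality.\<close>
    have "s < \<tau> w + max s (t - s)" if "w \<in> W" for w
      using W_pos[OF that] by simp
    moreover have "\<tau> v \<le> s + max s (t - s)" if "v \<in> V" for v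
      using \<tau>_t[OF that] by simp
    ultimately show ?thesis by (auto simp: T_def)
  qed
  then have "Y (max s (t - s)) = V"
    using TY YV by blast
  moreover have "card (T 0) = card B"
  proof -
    let ?A = "{w \<in> W. \<tau> w \<le> s}"
    have fin: "finite (X s)" "finite B"
      using finite_subset[OF _ pair_finite_verts] XV[of s] assms(2) by (simp_all add: V_def)
    have A: "?A = X s - B"
      using X_iff XV by (auto simp: W_def)
    have "B \<subseteq> X s"
      using blue_after_mono_time[of 0 s "std_force G" B] by (simp add: X_def)
    \<comment> \<open>Forcers are blue before the vertices they force, so removing them from
      \<open>X s\<close> removes exactly as many vertices as were forced by time
      \<open>s\<close>.\<close>
    have "f ` ?A \<subseteq> X s"
      using f_V f_less X_iff by fastforce
    moreover have "T 0 = X s - f ` ?A"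
      using X_iff XV by (fastforce simp: T_def)
    moreover have "card (f ` ?A) = card ?A"
      by (rule card_image) (auto intro: inj_onI f_inj)
    ultimately have "card (T 0) = card (X s) - card (X s - B)"
      using fin A by (simp add: card_Diff_subset)
    also have "\<dots> = card B"
      using fin \<open>B \<subseteq> X s\<close> by (simp add: card_Diff_subset card_mono)
    finally show ?thesis .
  qed
  ultimately show ?thesis
    by (intro exI[of _ "T 0"]) (auto simp: Y_def V_def T_def)
qed

section \<open>Passing to the minimum over sets of size \<open>m\<close>\<close>

lemma finite_forcing_sets:
  assumes "pair_graph G"
  shows "finite {B. forcing_set F G B \<and> card B = m}"
proof -
  interpret pair_graph G by fact
  have "{B. forcing_set F G B \<and> card B = m} \<subseteq> Pow (pverts G)"
    by (auto simp: forcing_set_def)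
  then show ?thesis
    using pair_finite_verts finite_subset by blast
qed

theorem theorem4p9:
  fixes G :: "'a pair_pre_digraph" and m :: nat
  assumes "pair_graph G"
    and "zero_forcing_number G \<le> m"
    and "m \<le> card (pverts G)"
  shows "int (pt_plus G m) \<le> \<lceil>real (pt G m) / 2\<rceil>"
proof -
  have "pt G m \<in> prop_time_set (std_force G) G ` {B. forcing_set (std_force G) G B \<and> card B = m}"
    unfolding pt_def prop_time_def
    using forcing_set_std_card_exists[OF assms] finite_forcing_sets[OF assms(1)]
    by (intro Min_in) auto
  then obtain B where B: "forcing_set (std_force G) G B" "card B = m"
    and pt: "pt G m = prop_time_set (std_force G) G B"
    by auto
  define t where "t = pt G m"
  \<comment> \<open>Half of \<open>t\<close> rounded up, in the form the split at
    \<open>t div 2\<close> produces.\<close>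
  define r where "r = max (t div 2) (t - t div 2)"
  have "blue_after (std_force G) B t = pverts G"
    using B LeastI_ex[of "\<lambda>k. blue_after (std_force G) B k = pverts G"]
    by (auto simp: forcing_set_def t_def pt prop_time_set_def)
  then obtain B' where B': "B' \<subseteq> pverts G" "card B' = m" "blue_after (psd_force G) B' r = pverts G"
    using psd_forcing_from_std_midpoint[OF assms(1), of B t "t div 2"] B
    by (auto simp: forcing_set_def r_def)
  then have "pt_plus G m \<le> prop_time_set (psd_force G) G B'"
    unfolding pt_plus_def prop_time_def
    using finite_forcing_sets[OF assms(1)] by (intro Min_le) (auto simp: forcing_set_def)
  also have "\<dots> \<le> r"
    unfolding prop_time_set_def using B'(3) by (rule Least_le)
  finally have "pt_plus G m \<le> r" .
  moreover have "int r \<le> \<lceil>real t / 2\<rceil>"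
    unfolding r_def by linarith
  ultimately show ?thesis
    by (simp add: t_def)
qed

end
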